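(* Let $n\ge3$, let $k$ be an integer with $1<k<n/2$, and let $q>\frac{nk}{n-2k}$. Consider the equation $$F_k(D^2u)=(-u)^q,\qquad u<0\text{ in }\mathbb{R}^n,$$ and the scaling transformation $u_\mu(x)=\mu^\sigma u(\mu x)$, $\mu>0$. The equation and the energy functional $\|(-u)\|_{L^{q+1}(\mathbb{R}^n)}$ are invariant under the scaling transformation (for some real exponent $\sigma$) if and only if $q=\frac{(n+2)k}{n-2k}$.
   Context: $F_k(D^2u)=S_k(\lambda(D^2u))$ is the $k$-Hessian operator, where $\lambda(D^2u)=(\lambda_1,\dots,\lambda_n)$ are the eigenvalues of the Hessian matrix $D^2u$ and $S_k(\lambda)=\sum_{1\le i_1<\cdots<i_k\le n}\lambda_{i_1}\cdots\lambda_{i_k}$. Invariance of the equation means: for every $\mu>0$ and every negative $C^2$ function $u$, $u_\mu$ satisfies the equation at $x$ exactly when $u$ satisfies it at $\mu x$. Invariance of the energy means that $\|(-u_\mu)\|_{L^{q+1}}=\|(-u)\|_{L^{q+1}}$ for every $\mu>0$ and every negative $u$. The same exponent $\sigma$ (independent of $\mu,u$) is used for both. *)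

theory Defs
  imports
    "HOL-Analysis.Analysis"
    "HOL-Computational_Algebra.Polynomial"
begin

definition partial_deriv :: "'n::finite \<Rightarrow> (real ^ 'n \<Rightarrow> real) \<Rightarrow> real ^ 'n \<Rightarrow> real" where
  "partial_deriv i f x = frechet_derivative f (at x) (axis i 1)"

definition C1_fun :: "(real ^ 'n::finite \<Rightarrow> real) \<Rightarrow> bool" where
  "C1_fun f \<longleftrightarrow> (\<forall>x. f differentiable (at x)) \<and> (\<forall>i. continuous_on UNIV (partial_deriv i f))"

definition C2_fun :: "(real ^ 'n::finite \<Rightarrow> real) \<Rightarrow> bool" where
  "C2_fun f \<longleftrightarrow> C1_fun f \<and> (\<forall>i. C1_fun (partial_deriv i f))"

definition hessian :: "(real ^ 'n::finite \<Rightarrow> real) \<Rightarrow> real ^ 'n \<Rightarrow> real ^ 'n ^ 'n" where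
  "hessian f x = (\<chi> i j. partial_deriv i (partial_deriv j f) x)"

definition charpoly :: "real ^ 'n ^ 'n::finite \<Rightarrow> real poly" where
  "charpoly A = det (mat [:0, 1:] - (\<chi> i j. [:A $ i $ j:]))"

text \<open>
  The real eigenvalues, in increasing order and repeated according to algebraic multiplicity;
  for a symmetric matrix this list has full length \<^term>\<open>CARD('n)\<close>.
\<close>
definition eigenvalues :: "real ^ 'n ^ 'n::finite \<Rightarrow> real list" where
  "eigenvalues A = sorted_list_of_multiset (proots (charpoly A))"

text \<open>
  Index tuples \<open>i\<^sub>1 < \<dots> < i\<^sub>k\<close> are represented by the \<open>k\<close>-element sets of list positions.
\<close>
definition elem_sym :: "nat \<Rightarrow> real list \<Rightarrow> real" where
  "elem_sym k l = (\<Sum>I | I \<subseteq> {..<length l} \<and> card I = k. \<Prod>i\<in>I. l ! i)"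

definition k_hessian :: "nat \<Rightarrow> real ^ 'n ^ 'n::finite \<Rightarrow> real" where
  "k_hessian k A = elem_sym k (eigenvalues A)"

definition hessian_equation_at ::
  "nat \<Rightarrow> real \<Rightarrow> (real ^ 'n::finite \<Rightarrow> real) \<Rightarrow> real ^ 'n \<Rightarrow> bool" where
  "hessian_equation_at k q u x \<longleftrightarrow> k_hessian k (hessian u x) = (- u x) powr q"

definition scaling :: "real \<Rightarrow> real \<Rightarrow> (real ^ 'n::finite \<Rightarrow> real) \<Rightarrow> real ^ 'n \<Rightarrow> real" where
  "scaling \<sigma> \<mu> u = (\<lambda>x. \<mu> powr \<sigma> * u (\<mu> *\<^sub>R x))"

text \<open>Extended-valued, so that it is \<open>\<infinity>\<close> exactly for functions outside \<open>L\<^sup>p\<close>.\<close>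
definition Lp_norm :: "real \<Rightarrow> (real ^ 'n::finite \<Rightarrow> real) \<Rightarrow> ennreal" where
  "Lp_norm p f =
    (let I = (\<integral>\<^sup>+ x. ennreal (\<bar>f x\<bar> powr p) \<partial>lebesgue)
     in if I = \<infinity> then \<infinity> else ennreal (enn2real I powr (1 / p)))"

definition equation_invariant :: "'n::finite itself \<Rightarrow> nat \<Rightarrow> real \<Rightarrow> real \<Rightarrow> bool" where
  "equation_invariant _ k q \<sigma> \<longleftrightarrow>
    (\<forall>\<mu>>0. \<forall>u :: real ^ 'n \<Rightarrow> real. C2_fun u \<longrightarrow> (\<forall>x. u x < 0) \<longrightarrow>
      (\<forall>x. hessian_equation_at k q (scaling \<sigma> \<mu> u) x \<longleftrightarrow> hessian_equation_at k q u (\<mu> *\<^sub>R x)))"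

definition energy_invariant :: "'n::finite itself \<Rightarrow> real \<Rightarrow> real \<Rightarrow> bool" where
  "energy_invariant _ q \<sigma> \<longleftrightarrow>
    (\<forall>\<mu>>0. \<forall>u :: real ^ 'n \<Rightarrow> real. u \<in> borel_measurable lebesgue \<longrightarrow> (\<forall>x. u x < 0) \<longrightarrow>
      Lp_norm (q + 1) (\<lambda>x. - scaling \<sigma> \<mu> u x) = Lp_norm (q + 1) (\<lambda>x. - u x))"

end

theory Submission
  imports Defs
begin

text \<open>
  Since \<open>D\<^sup>2u\<^sub>\<mu>(x) = \<mu>\<^bsup>\<sigma>+2\<^esup> D\<^sup>2u(\<mu>x)\<close> and the \<open>k\<close>-Hessian is homogeneous of degree \<open>k\<close>, the equation is
  invariant iff \<open>(\<sigma> + 2) k = \<sigma> q\<close>; necessity is seen on a negative trigonometric function that solves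
  the equation at the origin. By a linear change of variables the \<open>L\<^bsup>q+1\<^esup>\<close>-norm is multiplied by
  \<open>\<mu>\<^bsup>\<sigma>-n/(q+1)\<^esup>\<close>, so the energy is invariant iff \<open>\<sigma> (q + 1) = n\<close>; necessity is seen on any negative
  function of finite norm. Eliminating \<open>\<sigma>\<close> leaves \<open>n (q - k) = 2 k (q + 1)\<close>.
\<close>

section \<open>Homogeneity of eigenvalues and of the k-Hessian\<close>

text \<open>Substituting \<open>c x\<close> for \<open>x\<close> turns the factor
  \<open>x - c a\<close> into \<open>c (x - a)\<close>, so the full power of the first in
  \<open>p\<close> becomes a power of the second, and the cofactor still does not vanish at
  \<open>a\<close>.\<close>

lemma order_pcompose_linear:
  fixes p :: "'a::field poly"
  assumes "p \<noteq> 0" "c \<noteq> 0"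
  shows "order a (pcompose p [:0, c:]) = order (c * a) p"
proof -
  obtain r where r: "p = [:- (c * a), 1:] ^ order (c * a) p * r" "\<not> [:- (c * a), 1:] dvd r"
    using order_decomp[OF assms(1)] by blast
  let ?r = "smult (c ^ order (c * a) p) (pcompose r [:0, c:])"
  have "pcompose [:- (c * a), 1:] [:0, c:] = smult c [:- a, 1:]"
    by (simp add: pcompose_pCons)
  then have "pcompose ([:- (c * a), 1:] ^ m) [:0, c:] = smult (c ^ m) ([:- a, 1:] ^ m)" for m
    by (induction m) (simp_all add: pcompose_1 pcompose_mult mult.commute del: mult_pCons_left mult_pCons_right smult_pCons)
  then have "pcompose p [:0, c:] = [:- a, 1:] ^ order (c * a) p * ?r"
    by (subst r(1)) (simp add: pcompose_mult)
  moreover have "\<not> [:- a, 1:] dvd ?r"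
    using r(2) assms(2) by (simp add: dvd_smult_iff poly_eq_0_iff_dvd[symmetric] poly_pcompose mult.commute)
  ultimately show ?thesis
    by (intro order_unique_lemma)
      (simp_all only: power_Suc2 dvd_triv_left dvd_mult_cancel_left power_eq_0_iff, simp)
qed

lemma proots_pcompose_linear:
  fixes p :: "'a::field poly"
  assumes "c \<noteq> 0"
  shows "image_mset ((*) c) (proots (pcompose p [:0, c:])) = proots p"
proof (cases "p = 0")
  case False
  show ?thesis
  proof (rule multiset_eqI)
    fix x
    let ?M = "proots (pcompose p [:0, c:])"
    have "(*) c -` {x} = {x / c}"
      using assms by (auto simp: field_simps)
    then have "count (image_mset ((*) c) ?M) x = count ?M (x / c)"
      by (cases "x / c \<in># ?M") (simp_all add: count_image_mset not_in_iff)
    moreover have "pcompose p [:0, c:] \<noteq> 0"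
      using False assms by (simp add: pcompose_eq_0_iff)
    ultimately show "count (image_mset ((*) c) ?M) x = count (proots p) x"
      using False assms by (simp add: order_pcompose_linear)
  qed
qed simp

text \<open>This is \<open>det (c x I - c A) = c^n det (x I - A)\<close>, proved on each Leibniz
  term. Substituting \<open>c x\<close> on the left avoids any division by \<open>c\<close>.\<close>

lemma charpoly_scaleR:
  fixes A :: "real ^ 'n ^ 'n::finite"
  shows "pcompose (charpoly (c *\<^sub>R A)) [:0, c:] = smult (c ^ CARD('n)) (charpoly A)"
proof -
  let ?M = "\<lambda>A::real ^ 'n ^ 'n. mat [:0, 1:] - (\<chi> i j. [:A $ i $ j:])"
  have entry: "pcompose (?M (c *\<^sub>R A) $ i $ j) [:0, c:] = [:c:] * ?M A $ i $ j" for i j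
    by (simp add: mat_def pcompose_diff pcompose_pCons)
  have "pcompose (of_int (sign p) * (\<Prod>i\<in>UNIV. ?M (c *\<^sub>R A) $ i $ p i)) [:0, c:] =
      [:c:] ^ CARD('n) * (of_int (sign p) * (\<Prod>i\<in>UNIV. ?M A $ i $ p i))" for p
    unfolding pcompose_mult pcompose_prod entry prod.distrib
    by (simp add: sign_def pcompose_uminus pcompose_1)
  then have "pcompose (charpoly (c *\<^sub>R A)) [:0, c:] = [:c:] ^ CARD('n) * charpoly A"
    unfolding charpoly_def det_def pcompose_sum sum_distrib_left by simp
  then show ?thesis
    by (simp add: poly_const_pow)
qed

text \<open>The multisets of roots correspond under multiplication by \<open>c\<close>; positivity
  of \<open>c\<close> also preserves the order, so the sorted lists agree.\<close>

lemma eigenvalues_scaleR: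
  fixes A :: "real ^ 'n ^ 'n::finite"
  assumes "c > 0"
  shows "eigenvalues (c *\<^sub>R A) = map ((*) c) (eigenvalues A)"
proof -
  have "proots (charpoly (c *\<^sub>R A)) = image_mset ((*) c) (proots (charpoly A))"
    using proots_pcompose_linear[of c "charpoly (c *\<^sub>R A)"] assms by (simp add: charpoly_scaleR)
  moreover have "sorted (map ((*) c) (eigenvalues A))"
    using assms by (auto simp: eigenvalues_def sorted_map intro: sorted_wrt_mono_rel[OF _ sorted_sorted_list_of_multiset])
  moreover have "mset (map ((*) c) (eigenvalues A)) = image_mset ((*) c) (proots (charpoly A))"
    by (simp add: eigenvalues_def)
  ultimately show ?thesis
    unfolding eigenvalues_def by (metis sorted_list_of_multiset_mset sorted_sort_id)
qed

lemma k_hessian_scaleR: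
  fixes A :: "real ^ 'n ^ 'n::finite"
  assumes "c > 0"
  shows "k_hessian k (c *\<^sub>R A) = c ^ k * k_hessian k A"
proof -
  have "(\<Prod>i\<in>I. map ((*) c) l ! i) = c ^ k * (\<Prod>i\<in>I. l ! i)"
    if "I \<subseteq> {..<length l}" "card I = k" for I and l :: "real list"
  proof -
    have "(\<Prod>i\<in>I. map ((*) c) l ! i) = (\<Prod>i\<in>I. c * l ! i)"
      using that by (intro prod.cong) auto
    then show ?thesis using that by (simp add: prod.distrib)
  qed
  then show ?thesis
    unfolding k_hessian_def eigenvalues_scaleR[OF assms] elem_sym_def
    by (simp add: sum_distrib_left)
qed

text \<open>A scalar matrix has the single eigenvalue \<open>a\<close> with full multiplicity, so
  every \<open>k\<close>-subset contributes \<open>a ^ k\<close>.\<close>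

lemma k_hessian_mat: "k_hessian k (mat a :: real ^ 'n ^ 'n::finite) = real (CARD('n) choose k) * a ^ k"
proof -
  have "charpoly (mat a :: real ^ 'n ^ 'n) = [:- a, 1:] ^ CARD('n)"
    unfolding charpoly_def by (subst det_diagonal) (simp_all add: mat_def)
  then have "proots (charpoly (mat a :: real ^ 'n ^ 'n)) = replicate_mset CARD('n) a"
    by (simp add: proots_power)
  then have *: "eigenvalues (mat a :: real ^ 'n ^ 'n) = replicate CARD('n) a"
    unfolding eigenvalues_def
    by (metis mset_replicate sorted_list_of_multiset_mset sorted_replicate sorted_sort_id)
  have "(\<Sum>I | I \<subseteq> {..<CARD('n)} \<and> card I = k. \<Prod>i\<in>I. replicate CARD('n) a ! i) =
      (\<Sum>I | I \<subseteq> {..<CARD('n)} \<and> card I = k. a ^ k)"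
  proof (intro sum.cong refl)
    fix I assume "I \<in> {I. I \<subseteq> {..<CARD('n)} \<and> card I = k}"
    then have I: "I \<subseteq> {..<CARD('n)}" "card I = k" by auto
    then have "(\<Prod>i\<in>I. replicate CARD('n) a ! i) = (\<Prod>i\<in>I. a)"
      by (intro prod.cong) auto
    then show "(\<Prod>i\<in>I. replicate CARD('n) a ! i) = a ^ k" using I(2) by simp
  qed
  then show ?thesis
    using n_subsets[of "{..<CARD('n)}" k] by (simp add: k_hessian_def * elem_sym_def)
qed

section \<open>Scaling of the Hessian and of the equation\<close>

lemma partial_deriv_eqI:
  "(f has_derivative f') (at x) \<Longrightarrow> partial_deriv i f x = f' (axis i 1)"
  by (simp add: partial_deriv_def frechet_derivative_at[symmetric])

lemma partial_deriv_scaled: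
  assumes "f differentiable (at (\<mu> *\<^sub>R x))"
  shows "partial_deriv i (\<lambda>x. c * f (\<mu> *\<^sub>R x)) x = c * \<mu> * partial_deriv i f (\<mu> *\<^sub>R x)"
proof -
  let ?D = "frechet_derivative f (at (\<mu> *\<^sub>R x))"
  have D: "(f has_derivative ?D) (at (\<mu> *\<^sub>R x))"
    using assms frechet_derivative_works by blast
  have "((\<lambda>x. \<mu> *\<^sub>R x) has_derivative (\<lambda>x. \<mu> *\<^sub>R x)) (at x)"
    by (auto intro!: derivative_eq_intros)
  from has_derivative_compose[OF this D]
  have "((\<lambda>x. c * f (\<mu> *\<^sub>R x)) has_derivative (\<lambda>h. c * ?D (\<mu> *\<^sub>R h))) (at x)"
    by (intro has_derivative_mult_right)
  from partial_deriv_eqI[OF this] show ?thesis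
    using linear_scale[OF has_derivative_linear[OF D]] by (simp add: partial_deriv_def)
qed

lemma hessian_scaling:
  assumes "C2_fun u" "\<mu> > 0"
  shows "hessian (scaling \<sigma> \<mu> u) x = \<mu> powr (\<sigma> + 2) *\<^sub>R hessian u (\<mu> *\<^sub>R x)"
proof -
  have *: "u differentiable (at x)" "partial_deriv j u differentiable (at x)" for x j
    using assms(1) by (auto simp: C2_fun_def C1_fun_def)
  have "partial_deriv j (scaling \<sigma> \<mu> u) = (\<lambda>x. \<mu> powr \<sigma> * \<mu> * partial_deriv j u (\<mu> *\<^sub>R x))" for j
    unfolding scaling_def by (intro ext partial_deriv_scaled *)
  moreover have "\<mu> powr (\<sigma> + 2) = \<mu> powr \<sigma> * \<mu> * \<mu>"
    using assms(2) by (simp add: powr_add power2_eq_square)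
  ultimately show ?thesis
    by (simp add: hessian_def vec_eq_iff partial_deriv_scaled *)
qed

text \<open>Each side picks up its own power of \<mu>, so invariance becomes a comparison of the two
  exponents.\<close>

lemma hessian_equation_at_scaling:
  assumes "C2_fun u" "\<And>x. u x < 0" "\<mu> > 0"
  shows "hessian_equation_at k q (scaling \<sigma> \<mu> u) x \<longleftrightarrow>
    \<mu> powr ((\<sigma> + 2) * k) * k_hessian k (hessian u (\<mu> *\<^sub>R x)) =
    \<mu> powr (\<sigma> * q) * (- u (\<mu> *\<^sub>R x)) powr q"
proof -
  have "(- scaling \<sigma> \<mu> u x) powr q = \<mu> powr (\<sigma> * q) * (- u (\<mu> *\<^sub>R x)) powr q"
    using powr_mult[of "\<mu> powr \<sigma>" "- u (\<mu> *\<^sub>R x)" q] assms(2)[of "\<mu> *\<^sub>R x"]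
    by (simp add: scaling_def powr_powr)
  moreover have "(\<mu> powr (\<sigma> + 2)) ^ k = \<mu> powr ((\<sigma> + 2) * k)"
    using assms(3) by (simp add: powr_powr flip: powr_realpow)
  ultimately show ?thesis
    using assms by (simp add: hessian_equation_at_def hessian_scaling k_hessian_scaleR)
qed

section \<open>Trigonometric test functions\<close>

text \<open>In this family \<open>a\<close> prescribes the Hessian at the origin, while a large
  constant \<open>b\<close> makes the function negative everywhere.\<close>

lemma has_derivative_sum_cos:
  "((\<lambda>x::real ^ 'n::finite. - b - a * (\<Sum>i\<in>UNIV. cos (x $ i))) has_derivative
    (\<lambda>h. a * (\<Sum>i\<in>UNIV. sin (x $ i) * h $ i))) (at x)"
  by (auto intro!: derivative_eq_intros bounded_linear_imp_has_derivative[OF bounded_linear_vec_nth] simp: sum_negf algebra_simps)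

lemma has_derivative_sin_component:
  "((\<lambda>x::real ^ 'n::finite. a * sin (x $ j)) has_derivative (\<lambda>h. a * cos (x $ j) * h $ j)) (at x)"
  by (auto intro!: derivative_eq_intros bounded_linear_imp_has_derivative[OF bounded_linear_vec_nth] simp: algebra_simps)

lemma partial_deriv_sum_cos:
  "partial_deriv j (\<lambda>x::real ^ 'n::finite. - b - a * (\<Sum>i\<in>UNIV. cos (x $ i))) = (\<lambda>x. a * sin (x $ j))"
  by (rule ext, subst partial_deriv_eqI[OF has_derivative_sum_cos])
    (simp add: axis_def if_distrib[of "(*) _"] cong: if_cong)

lemma partial_deriv_sin_component:
  "partial_deriv i (\<lambda>x::real ^ 'n::finite. a * sin (x $ j)) = (\<lambda>x. if i = j then a * cos (x $ j) else 0)"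
  by (rule ext, subst partial_deriv_eqI[OF has_derivative_sin_component]) (simp add: axis_def)

lemma C2_fun_sum_cos: "C2_fun (\<lambda>x::real ^ 'n::finite. - b - a * (\<Sum>i\<in>UNIV. cos (x $ i)))"
proof -
  have "continuous_on UNIV (\<lambda>x::real ^ 'n. if i = j then a * cos (x $ j) else 0)" for i j
    by (cases "i = j") (auto intro!: continuous_intros)
  then show ?thesis
    unfolding C2_fun_def C1_fun_def partial_deriv_sum_cos partial_deriv_sin_component
    by (intro conjI allI continuous_intros differentiableI[OF has_derivative_sum_cos]
        differentiableI[OF has_derivative_sin_component])
qed

lemma hessian_sum_cos_0:
  "hessian (\<lambda>x::real ^ 'n::finite. - b - a * (\<Sum>i\<in>UNIV. cos (x $ i))) 0 = mat a"
  by (simp add: hessian_def partial_deriv_sum_cos partial_deriv_sin_component mat_def vec_eq_iff)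

text \<open>The bound on \<open>k\<close> keeps the binomial coefficient positive, and
  \<open>q > real k\<close> allows the root of order \<open>q - k\<close> that yields a point
  solution.\<close>

lemma equation_invariant_iff:
  assumes "k \<le> CARD('n::finite)" "q > real k"
  shows "equation_invariant TYPE('n) k q \<sigma> \<longleftrightarrow> (\<sigma> + 2) * k = \<sigma> * q"
proof
  assume inv: "equation_invariant TYPE('n) k q \<sigma>"
  define n where "n = real CARD('n)"
  define C where "C = real (CARD('n) choose k)"
  have pos: "n > 0" "C > 0" using assms(1) by (auto simp: n_def C_def)
  \<comment> \<open>\<open>a\<close> solves \<open>C a\<^sup>k = (3 n a) powr q\<close>, the equation for \<open>u\<close> at the origin, where \<open>D\<^sup>2u\<close> is \<open>a\<close> times the identity.\<close>
  define a where "a = (C / (3 * n) powr q) powr (1 / (q - k))"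
  have a: "a > 0" using pos by (simp add: a_def)
  \<comment> \<open>The cosine sum lies between \<open>- n\<close> and \<open>n\<close>, so the
    shift \<open>2 * n * a\<close> gives \<open>u x \<le> - n * a\<close>; at the origin it gives
    the value \<open>- 3 * n * a\<close> anticipated in \<open>a\<close>.\<close>
  define u where "u = (\<lambda>x::real ^ 'n. - (2 * n * a) - a * (\<Sum>i\<in>UNIV. cos (x $ i)))"
  have C2: "C2_fun u" unfolding u_def by (rule C2_fun_sum_cos)
  have neg: "u x < 0" for x
  proof -
    have "(\<Sum>i\<in>UNIV. cos (x $ i)) \<ge> (\<Sum>i\<in>(UNIV :: 'n set). - 1)"
      by (intro sum_mono) simp
    then have "a * (\<Sum>i\<in>UNIV. cos (x $ i)) \<ge> a * - n"
      using a by (intro mult_left_mono) (simp_all add: n_def)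
    moreover have "a * n > 0" using a pos by simp
    ultimately show ?thesis by (simp add: u_def algebra_simps)
  qed
  have u0: "- u 0 = 3 * n * a" by (simp add: u_def n_def)
  have H: "k_hessian k (hessian u 0) = C * a ^ k"
    unfolding u_def hessian_sum_cos_0 k_hessian_mat C_def ..
  have "a powr (q - k) = C / (3 * n) powr q"
    using assms(2) pos by (simp add: a_def powr_powr)
  then have "C * a ^ k = (3 * n) powr q * (a powr (q - k) * a powr k)"
    using a pos by (simp add: powr_realpow)
  also have "\<dots> = (3 * n * a) powr q"
    using a pos by (simp add: powr_mult flip: powr_add)
  finally have eq: "C * a ^ k = (- u 0) powr q" by (simp add: u0)
  \<comment> \<open>The origin is fixed by dilations, so solving the equation at this one point
    suffices to test invariance with \<mu> = 2.\<close>
  then have "hessian_equation_at k q u ((2::real) *\<^sub>R 0)"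
    by (simp add: hessian_equation_at_def H)
  then have "hessian_equation_at k q (scaling \<sigma> 2 u) 0"
    using inv C2 neg unfolding equation_invariant_def by (metis zero_less_numeral)
  then have "2 powr ((\<sigma> + 2) * k) * (C * a ^ k) = 2 powr (\<sigma> * q) * (C * a ^ k)"
    by (simp add: hessian_equation_at_scaling[OF C2 neg] H eq)
  then have "(2::real) powr ((\<sigma> + 2) * k) = 2 powr (\<sigma> * q)"
    using a pos by simp
  then show "(\<sigma> + 2) * k = \<sigma> * q"
    by (simp add: powr_inj)
next
  assume "(\<sigma> + 2) * k = \<sigma> * q"
  then show "equation_invariant TYPE('n) k q \<sigma>"
    \<comment> \<open>The equation is unfolded only in the second call, so that the scaling rule can
      first match \<open>hessian_equation_at\<close>; the common power of \<mu> cancels.\<close>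
    by (simp add: equation_invariant_def hessian_equation_at_scaling) (simp add: hessian_equation_at_def)
qed

section \<open>Scaling of the energy\<close>

lemma nn_integral_lebesgue_scaleR:
  fixes f :: "'a::euclidean_space \<Rightarrow> ennreal"
  assumes [measurable]: "f \<in> borel_measurable lebesgue" and "c > 0"
  shows "(\<integral>\<^sup>+x. f x \<partial>lebesgue) = ennreal (c ^ DIM('a)) * (\<integral>\<^sup>+x. f (c *\<^sub>R x) \<partial>lebesgue)"
proof -
  \<comment> \<open>The affine change of variables stretches each coordinate separately; equal
    factors and no translation give the dilation.\<close>
  have T: "0 + (\<Sum>j\<in>Basis. (c * (x \<bullet> j)) *\<^sub>R j) = c *\<^sub>R x" for x :: 'a
    by (simp add: euclidean_representation flip: scaleR_scaleR scaleR_sum_right)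
  have "lebesgue = density (distr lebesgue lebesgue (\<lambda>x::'a. c *\<^sub>R x)) (\<lambda>_. ennreal (c ^ DIM('a)))"
    using lebesgue_affine_euclidean[of "\<lambda>_::'a. c" 0] assms(2) unfolding T by simp
  then have "(\<integral>\<^sup>+x. f x \<partial>lebesgue) =
      (\<integral>\<^sup>+x. f x \<partial>density (distr lebesgue lebesgue (\<lambda>x::'a. c *\<^sub>R x)) (\<lambda>_. ennreal (c ^ DIM('a))))"
    by simp
  also have "\<dots> = ennreal (c ^ DIM('a)) * (\<integral>\<^sup>+x. f (c *\<^sub>R x) \<partial>lebesgue)"
    by (subst nn_integral_density) (simp_all add: nn_integral_distr nn_integral_cmult)
  finally show ?thesis .
qed

text \<open>The amplitude contributes \<open>\<mu> powr (\<sigma> * p)\<close> to the integral and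
  the change of variables divides it by \<open>\<mu> powr n\<close>, where
  \<open>n = CARD('n)\<close>; then the \<open>p\<close>-th root is taken.\<close>

lemma Lp_norm_scaling:
  fixes u :: "real ^ 'n::finite \<Rightarrow> real"
  assumes [measurable]: "u \<in> borel_measurable lebesgue" and "\<mu> > 0" "p > 0"
  shows "Lp_norm p (\<lambda>x. - scaling \<sigma> \<mu> u x) =
    ennreal (\<mu> powr (\<sigma> - CARD('n) / p)) * Lp_norm p (\<lambda>x. - u x)"
proof -
  define I where "I = (\<integral>\<^sup>+x. ennreal (\<bar>u x\<bar> powr p) \<partial>lebesgue)"
  define J where "J = (\<integral>\<^sup>+x. ennreal (\<bar>u (\<mu> *\<^sub>R x)\<bar> powr p) \<partial>lebesgue)"
  have um[measurable]: "(\<lambda>x. u (\<mu> *\<^sub>R x)) \<in> borel_measurable lebesgue"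
    by (rule measurable_compose[OF lebesgue_measurable_scaling assms(1)])
  have IJ: "I = ennreal (\<mu> powr CARD('n)) * J"
    unfolding I_def J_def using assms(2)
    by (subst nn_integral_lebesgue_scaleR[of _ \<mu>]) (simp_all add: powr_realpow)
  have "(\<integral>\<^sup>+x. ennreal (\<bar>scaling \<sigma> \<mu> u x\<bar> powr p) \<partial>lebesgue) =
      (\<integral>\<^sup>+x. ennreal (\<mu> powr (\<sigma> * p)) * ennreal (\<bar>u (\<mu> *\<^sub>R x)\<bar> powr p) \<partial>lebesgue)"
    by (intro nn_integral_cong) (simp add: scaling_def abs_mult powr_mult powr_powr ennreal_mult)
  also have "\<dots> = ennreal (\<mu> powr (\<sigma> * p)) * J"
    unfolding J_def by (rule nn_integral_cmult) measurable
  also have "\<dots> = ennreal (\<mu> powr (\<sigma> * p - CARD('n))) * I"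
    unfolding IJ mult.assoc[symmetric] by (simp add: ennreal_mult[symmetric] powr_add[symmetric])
  finally have S: "(\<integral>\<^sup>+x. ennreal (\<bar>scaling \<sigma> \<mu> u x\<bar> powr p) \<partial>lebesgue) =
    ennreal (\<mu> powr (\<sigma> * p - CARD('n))) * I" .
  have e: "(\<mu> powr (\<sigma> * p - CARD('n))) powr (1 / p) = \<mu> powr (\<sigma> - CARD('n) / p)"
    using assms(3) by (simp add: powr_powr diff_divide_distrib)
  show ?thesis
  \<comment> \<open>The infinite branch of \<open>Lp_norm\<close> is treated apart; a positive
    finite factor preserves it.\<close>
  proof (cases "I = \<infinity>")
    case True
    then show ?thesis
      using assms(2) by (simp add: Lp_norm_def S ennreal_mult_top Let_def flip: I_def)
  next
    case False
    then have "ennreal (\<mu> powr (\<sigma> * p - CARD('n))) * I \<noteq> \<infinity>"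
      by (simp add: ennreal_mult_eq_top_iff)
    then show ?thesis
      using False by (simp add: Lp_norm_def S e Let_def enn2real_mult powr_mult ennreal_mult flip: I_def)
  qed
qed

text \<open>Sigma-finiteness of Lebesgue measure supplies a strictly positive \<open>h\<close> with
  finite integral; minus its \<open>p\<close>-th root is the required function.\<close>

lemma ex_negative_finite_Lp_norm:
  assumes "p > 0"
  obtains u :: "real ^ 'n::finite \<Rightarrow> real" where "u \<in> borel_measurable lebesgue" "\<And>x. u x < 0"
    "Lp_norm p (\<lambda>x. - u x) \<noteq> 0" "Lp_norm p (\<lambda>x. - u x) \<noteq> \<infinity>"
proof -
  obtain h :: "real ^ 'n \<Rightarrow> ennreal" where h[measurable]: "h \<in> borel_measurable lborel"
    and fin: "integral\<^sup>N lborel h \<noteq> \<infinity>" and hx: "\<And>x. 0 < h x \<and> h x < \<infinity>"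
    using sigma_finite_measure.Ex_finite_integrable_function[OF sigma_finite_lborel] by auto
  define u where "u = (\<lambda>x. - (enn2real (h x) powr (1 / p)))"
  have pos: "enn2real (h x) > 0" for x using hx[of x] by (simp add: enn2real_positive_iff)
  have "ennreal (\<bar>- u x\<bar> powr p) = h x" for x
    using assms pos[of x] hx[of x] by (simp add: u_def powr_powr)
  then have I: "(\<integral>\<^sup>+x. ennreal (\<bar>- u x\<bar> powr p) \<partial>lebesgue) = integral\<^sup>N lborel h"
    by (simp add: nn_integral_completion)
  \<comment> \<open>A zero integral would make the positive \<open>h\<close> vanish almost
    everywhere, yet the whole space is not a null set.\<close>
  have "integral\<^sup>N lborel h \<noteq> 0"
  proof
    assume "integral\<^sup>N lborel h = 0"
    then have "AE x in lborel. h x = 0" by (simp add: nn_integral_0_iff_AE)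
    then have "AE x in lborel :: (real ^ 'n) measure. False"
      by eventually_elim (use hx in \<open>metis less_irrefl\<close>)
    then show False using AE_iff_null[of "lborel :: (real ^ 'n) measure" "\<lambda>_. False"] by (simp add: null_sets_def)
  qed
  then have "enn2real (integral\<^sup>N lborel h) > 0"
    using fin by (simp add: enn2real_positive_iff less_top zero_less_iff_neq_zero)
  moreover have "u \<in> borel_measurable lebesgue"
    unfolding u_def by (rule measurable_completion) measurable
  moreover have "u x < 0" for x
    using pos[of x] by (simp add: u_def)
  ultimately show ?thesis
    using that[of u] fin unfolding Lp_norm_def I Let_def by simp
qed

lemma energy_invariant_iff:
  assumes "q + 1 > 0"
  shows "energy_invariant TYPE('n::finite) q \<sigma> \<longleftrightarrow> \<sigma> * (q + 1) = CARD('n)"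
proof
  assume inv: "energy_invariant TYPE('n) q \<sigma>"
  obtain u :: "real ^ 'n::finite \<Rightarrow> real" where u: "u \<in> borel_measurable lebesgue" "\<And>x. u x < 0"
    and N: "Lp_norm (q + 1) (\<lambda>x. - u x) \<noteq> 0" "Lp_norm (q + 1) (\<lambda>x. - u x) \<noteq> \<infinity>"
    using ex_negative_finite_Lp_norm[OF assms] by metis
  have "Lp_norm (q + 1) (\<lambda>x. - scaling \<sigma> 2 u x) = Lp_norm (q + 1) (\<lambda>x. - u x)"
    using inv u by (simp add: energy_invariant_def)
  then have "ennreal (2 powr (\<sigma> - CARD('n) / (q + 1))) * Lp_norm (q + 1) (\<lambda>x. - u x) =
      1 * Lp_norm (q + 1) (\<lambda>x. - u x)"
    using Lp_norm_scaling[OF u(1) _ assms, of 2 \<sigma>] by simp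
  \<comment> \<open>Cancellation in \<open>ennreal\<close> is legitimate because the norm is neither
    zero nor infinite.\<close>
  then have "ennreal (2 powr (\<sigma> - CARD('n) / (q + 1))) = 1"
    using N by (metis ennreal_mult_cancel_left mult.commute infinity_ennreal_def)
  then have "2 powr (\<sigma> - CARD('n) / (q + 1)) = (2::real) powr 0"
    by (simp add: ennreal_eq_1)
  then have "\<sigma> - CARD('n) / (q + 1) = 0"
    by (subst (asm) powr_inj) auto
  then show "\<sigma> * (q + 1) = CARD('n)"
    using assms by (simp add: field_simps)
next
  assume "\<sigma> * (q + 1) = CARD('n)"
  then have "\<sigma> - CARD('n) / (q + 1) = 0"
    using assms by (simp add: field_simps)
  then show "energy_invariant TYPE('n) q \<sigma>"
    using assms by (simp add: energy_invariant_def Lp_norm_scaling)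
qed

section \<open>Elimination of the scaling exponent\<close>

theorem theorem4p3:
  fixes n k :: nat and q :: real
  assumes "n = CARD('n::finite)"
    and "n \<ge> 3"
    and "1 < k"
    and "real k < real n / 2"
    and "q > real n * real k / (real n - 2 * real k)"
  shows "(\<exists>\<sigma> :: real. equation_invariant TYPE('n) k q \<sigma> \<and> energy_invariant TYPE('n) q \<sigma>) \<longleftrightarrow>
    q = (real n + 2) * real k / (real n - 2 * real k)"
proof -
  have d: "real n - 2 * real k > 0" using assms(4) by simp
  \<comment> \<open>This shows that the assumed lower bound on \<open>q\<close> is at least
    \<open>k\<close>.\<close>
  have "real k * (real n - 2 * real k) \<le> real n * real k"
    by (simp add: algebra_simps)
  then have "real k \<le> real n * real k / (real n - 2 * real k)"
    using d by (simp add: pos_le_divide_eq)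
  then have q: "q > real k" using assms(5) by simp
  have "k \<le> CARD('n)" using assms(1,4) by linarith
  then have eq: "equation_invariant TYPE('n) k q \<sigma> \<longleftrightarrow> (\<sigma> + 2) * k = \<sigma> * q" for \<sigma>
    using q by (rule equation_invariant_iff)
  have en: "energy_invariant TYPE('n) q \<sigma> \<longleftrightarrow> \<sigma> * (q + 1) = n" for \<sigma>
    unfolding assms(1) using q by (intro energy_invariant_iff) simp
  have crit: "q = (real n + 2) * real k / (real n - 2 * real k) \<longleftrightarrow> n * (q - k) = 2 * k * (q + 1)"
    using d by (auto simp: field_simps)
  show ?thesis
    unfolding eq en crit
  proof
    assume "\<exists>\<sigma>::real. (\<sigma> + 2) * k = \<sigma> * q \<and> \<sigma> * (q + 1) = n"
    then obtain \<sigma> :: real where s: "(\<sigma> + 2) * k = \<sigma> * q" "\<sigma> * (q + 1) = n" by blast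
    \<comment> \<open>The energy relation replaces \<open>n\<close> by
      \<open>\<sigma> * (q + 1)\<close>; the equation relation then evaluates the first factor as
      \<open>2 * k\<close>.\<close>
    have "n * (q - k) = (\<sigma> * q - \<sigma> * k) * (q + 1)"
      unfolding s(2)[symmetric] by (simp add: algebra_simps)
    also have "\<sigma> * q - \<sigma> * k = 2 * k"
      unfolding s(1)[symmetric] by (simp add: algebra_simps)
    finally show "n * (q - k) = 2 * k * (q + 1)" .
  next
    assume *: "n * (q - k) = 2 * k * (q + 1)"
    have "q + 1 > 0" using q by simp
    \<comment> \<open>The witness \<open>n / (q + 1)\<close> is the only exponent that the energy
      relation permits.\<close>
    then have "(n / (q + 1) + 2) * k = n / (q + 1) * q" "n / (q + 1) * (q + 1) = n"
      using * by (simp_all add: field_simps)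
    then show "\<exists>\<sigma>::real. (\<sigma> + 2) * k = \<sigma> * q \<and> \<sigma> * (q + 1) = n" by blast
  qed
qed

end
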